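(* Let $X$ be a completely regular space and let $\mathscr{P}$ be a closed hereditary topological property preserved under finite sums of closed subspaces. The following are equivalent: (1) $X$ is $\mathscr{P}$-connected. (2) The subspace $\beta X\setminus\lambda_{\mathscr{P}}X$ of $\beta X$ is connected.
   Context: A topological property is a property of topological spaces invariant under homeomorphism. Completely regular spaces are taken to be Hausdorff (i.e. Tychonoff). A zero-set of a space $X$ is a set $f^{-1}(0)$ with $f:X\to[0,1]$ continuous; a cozero-set of $X$ is the complement in $X$ of a zero-set. $\mathrm{Coz}(X)$ denotes the set of all cozero-sets of $X$. Let $\mathscr{P}$ be a topological property. A $\mathscr{P}$-separation for a space $X$ is a pair $C,D\in\mathrm{Coz}(X)$ such that: $C$ and $D$ are disjoint; neither $\mathrm{cl}_XC$ nor $\mathrm{cl}_XD$ has $\mathscr{P}$; and $X\setminus(C\cup D)\subseteq E$ for some $E\in\mathrm{Coz}(X)$ such that $\mathrm{cl}_XE$ has $\mathscr{P}$. The space $X$ is $\mathscr{P}$-disconnected if there is a $\mathscr{P}$-separation for it, and $\mathscr{P}$-connected otherwise. $\mathscr{P}$ is closed hereditary if every closed subspace of a space with $\mathscr{P}$ has $\mathscr{P}$. $\mathscr{P}$ is preserved under finite sums of closed subspaces if any space that is a finite union of closed subspaces each having $\mathscr{P}$ also has $\mathscr{P}$ (the empty union is allowed, so the empty space has $\mathscr{P}$). $\beta X$ is the Stone–Čech compactification of $X$ (with $X\subseteq\beta X$), and $$\lambda_{\mathscr{P}}X=\bigcup\{\mathrm{int}_{\beta X}\mathrm{cl}_{\beta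 X}C : C\in\mathrm{Coz}(X)\text{ and }\mathrm{cl}_XC\text{ has }\mathscr{P}\}.$$ A space is connected if it is not the union of two disjoint non-empty closed subsets; in particular the empty space is connected. *)

theory Defs
  imports "HOL-Analysis.Analysis"
begin

text \<open>
  A topological property is a predicate \<open>P :: 'a topology \<Rightarrow> bool\<close> that respects homeomorphism.
  A value of type \<open>'a topology\<close> may have any subset of \<open>'a\<close> as its space, so the spaces on
  which \<open>P\<close> is defined include all subspaces of a given space.
\<close>

definition topological_property :: "('a topology \<Rightarrow> bool) \<Rightarrow> bool" where
  "topological_property P \<longleftrightarrow> (\<forall>X Y. X homeomorphic_space Y \<longrightarrow> P X \<longrightarrow> P Y)"

definition closed_hereditary :: "('a topology \<Rightarrow> bool) \<Rightarrow> bool" where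
  "closed_hereditary P \<longleftrightarrow> (\<forall>X S. P X \<longrightarrow> closedin X S \<longrightarrow> P (subtopology X S))"

text \<open>The family \<open>\<F>\<close> may be empty, so such a \<open>P\<close> holds of the empty space.\<close>

definition preserved_under_finite_closed_sums :: "('a topology \<Rightarrow> bool) \<Rightarrow> bool" where
  "preserved_under_finite_closed_sums P \<longleftrightarrow>
     (\<forall>X \<F>. finite \<F> \<longrightarrow> (\<forall>S\<in>\<F>. closedin X S \<and> P (subtopology X S)) \<longrightarrow>
        \<Union>\<F> = topspace X \<longrightarrow> P X)"

definition zero_set_in :: "'a topology \<Rightarrow> 'a set \<Rightarrow> bool" where
  "zero_set_in X Z \<longleftrightarrow>
     (\<exists>f. continuous_map X (top_of_set {0..1::real}) f \<and> Z = {x \<in> topspace X. f x = 0})"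

definition Coz :: "'a topology \<Rightarrow> 'a set set" where
  "Coz X = {topspace X - Z | Z. zero_set_in X Z}"

definition P_separation :: "('a topology \<Rightarrow> bool) \<Rightarrow> 'a topology \<Rightarrow> 'a set \<Rightarrow> 'a set \<Rightarrow> bool" where
  "P_separation P X C D \<longleftrightarrow>
     C \<in> Coz X \<and> D \<in> Coz X \<and> disjnt C D \<and>
     \<not> P (subtopology X (X closure_of C)) \<and> \<not> P (subtopology X (X closure_of D)) \<and>
     (\<exists>E \<in> Coz X. topspace X - (C \<union> D) \<subseteq> E \<and> P (subtopology X (X closure_of E)))"

definition P_disconnected :: "('a topology \<Rightarrow> bool) \<Rightarrow> 'a topology \<Rightarrow> bool" where
  "P_disconnected P X \<longleftrightarrow> (\<exists>C D. P_separation P X C D)"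

definition P_connected :: "('a topology \<Rightarrow> bool) \<Rightarrow> 'a topology \<Rightarrow> bool" where
  "P_connected P X \<longleftrightarrow> \<not> P_disconnected P X"

text \<open>
  The Stone--Cech compactification is the closure of the image of \<open>X\<close> in the cube
  \<open>[0,1]\<^bsup>C(X,[0,1])\<^esup>\<close>. Functions are taken extensional so that each element of \<open>C(X,[0,1])\<close>
  indexes exactly one coordinate. The inclusion of \<open>X\<close> is the evaluation map \<open>sc_embed X\<close>.
\<close>

definition unit_maps :: "'a topology \<Rightarrow> ('a \<Rightarrow> real) set" where
  "unit_maps X = {f \<in> extensional (topspace X). continuous_map X (top_of_set {0..1}) f}"

definition unit_cube :: "'a topology \<Rightarrow> (('a \<Rightarrow> real) \<Rightarrow> real) topology" where
  "unit_cube X = product_topology (\<lambda>f. top_of_set {0..1}) (unit_maps X)"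

definition sc_embed :: "'a topology \<Rightarrow> 'a \<Rightarrow> (('a \<Rightarrow> real) \<Rightarrow> real)" where
  "sc_embed X x = (\<lambda>f \<in> unit_maps X. f x)"

definition stone_cech :: "'a topology \<Rightarrow> (('a \<Rightarrow> real) \<Rightarrow> real) topology" where
  "stone_cech X = subtopology (unit_cube X) (unit_cube X closure_of (sc_embed X ` topspace X))"

definition P_lambda :: "('a topology \<Rightarrow> bool) \<Rightarrow> 'a topology \<Rightarrow> (('a \<Rightarrow> real) \<Rightarrow> real) set" where
  "P_lambda P X =
     \<Union> {stone_cech X interior_of (stone_cech X closure_of (sc_embed X ` C)) | C.
          C \<in> Coz X \<and> P (subtopology X (X closure_of C))}"

text \<open>
  The defining properties of the Stone--Cech compactification: compact Hausdorff, containing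
  \<open>X\<close> as a dense subspace, and such that every continuous map \<open>X \<rightarrow> [0,1]\<close> extends.
\<close>

lemma compact_space_stone_cech: "compact_space (stone_cech X)"
proof -
  have "compact_space (top_of_set {0..1::real})"
    by (simp add: compact_space_subtopology)
  then have "compact_space (unit_cube X)"
    unfolding unit_cube_def compact_space_product_topology by blast
  then show ?thesis
    unfolding stone_cech_def
    by (meson closedin_closure_of closedin_compact_space compact_space_subtopology)
qed

lemma Hausdorff_space_stone_cech: "Hausdorff_space (stone_cech X)"
  unfolding stone_cech_def unit_cube_def
  by (simp add: Hausdorff_space_subtopology Hausdorff_space_product_topology)

lemma sc_embed_in_unit_cube: "sc_embed X ` topspace X \<subseteq> topspace (unit_cube X)"
  by (fastforce simp: sc_embed_def unit_cube_def unit_maps_def continuous_map_in_subtopology)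

lemma sc_embed_in_closure:
  "sc_embed X ` topspace X \<subseteq> unit_cube X closure_of (sc_embed X ` topspace X)"
  by (rule closure_of_subset[OF sc_embed_in_unit_cube])

lemma dense_sc_embed: "stone_cech X closure_of (sc_embed X ` topspace X) = topspace (stone_cech X)"
  unfolding stone_cech_def closure_of_subtopology topspace_subtopology
    Int_absorb1[OF sc_embed_in_closure]
  using closure_of_subset_topspace[of "unit_cube X" "sc_embed X ` topspace X"] by blast

lemma unit_maps_eq_mspace:
  "unit_maps X = mspace (submetric (cfunspace X euclidean_metric) {f. f \<in> topspace X \<rightarrow> {0..1::real}})"
proof -
  have "bounded (f ` topspace X)" if "f \<in> topspace X \<rightarrow> {0..1::real}" for f
    using bounded_subset[OF bounded_closed_interval[of 0 1], of "f ` topspace X"] that by auto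
  then show ?thesis
    unfolding unit_maps_def continuous_map_in_subtopology image_subset_iff_funcset
    by (intro set_eqI iffI) simp_all
qed

lemma embedding_map_sc_embed:
  assumes "completely_regular_space X" "Hausdorff_space X"
  shows "embedding_map X (stone_cech X) (sc_embed X)"
proof -
  have "embedding_map X (unit_cube X) (sc_embed X)"
    using completely_regular_space_cube_embedding_explicit[OF assms]
    unfolding unit_cube_def sc_embed_def[abs_def] unit_maps_eq_mspace .
  then show ?thesis
    by (simp add: stone_cech_def embedding_map_in_subtopology sc_embed_in_closure)
qed

lemma stone_cech_extension:
  assumes "continuous_map X (top_of_set {0..1}) f"
  obtains g where "continuous_map (stone_cech X) (top_of_set {0..1::real}) g"
    and "\<And>x. x \<in> topspace X \<Longrightarrow> g (sc_embed X x) = f x"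
proof
  define h where "h = restrict f (topspace X)"
  have h: "h \<in> unit_maps X"
    using continuous_map_eq[OF assms, of h] by (simp add: h_def unit_maps_def)
  show "continuous_map (stone_cech X) (top_of_set {0..1}) (\<lambda>p. p h)"
    unfolding stone_cech_def unit_cube_def
    using continuous_map_product_projection[OF h, of "\<lambda>f. top_of_set {0..1}"]
    by (rule continuous_map_from_subtopology)
  show "sc_embed X x h = f x" if "x \<in> topspace X" for x
    using that h by (simp add: sc_embed_def h_def)
qed

end

theory Submission
  imports Defs
begin

text \<open>
  Write \<open>B\<close> for the Stone--Cech compactification and \<open>L\<close> for the open set \<open>\<lambda>\<^sub>P X\<close>. By
  compactness, a set \<open>A\<close> whose closure in \<open>B\<close> lies in \<open>L\<close> has a closure in \<open>X\<close> with \<open>P\<close>.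

  If \<open>B - L\<close> is the union of disjoint non-empty closed sets \<open>H\<close> and \<open>K\<close>, take a Urysohn function
  \<open>F\<close> with values \<open>0\<close> on \<open>H\<close> and \<open>1\<close> on \<open>K\<close>. The traces on \<open>X\<close> of \<open>F < 1/3\<close> and \<open>F > 2/3\<close> form a
  separation, with \<open>E\<close> the trace of \<open>1/4 < F < 3/4\<close>.

  Conversely let \<open>f\<close>, \<open>g\<close>, \<open>h\<close> be non-negative with cozero-sets \<open>C\<close>, \<open>D\<close>, \<open>E\<close> forming a separation.
  Then \<open>(1 + (f - g) / (f + g + h)) / 2\<close> extends to \<open>W\<close> on \<open>B\<close>. The open set \<open>0 < W < 1\<close> has its
  trace in \<open>E\<close>, so it lies in \<open>L\<close>, and \<open>W = 0\<close> and \<open>W = 1\<close> split \<open>B - L\<close>. If \<open>W = 1\<close> did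
  not meet \<open>B - L\<close> then \<open>W \<ge> 1/2\<close> would lie in \<open>L\<close>, and so the closure of \<open>C\<close> would have \<open>P\<close>.
\<close>

section \<open>Cozero-sets as positivity sets of real functions\<close>

lemma Coz_positive_set:
  assumes "continuous_map X euclideanreal f"
  shows "{x \<in> topspace X. 0 < f x} \<in> Coz X"
proof -
  \<comment> \<open>Truncation to the unit interval turns all values \<open>f x \<le> 0\<close> into
    \<open>0\<close> and keeps positive values positive.\<close>
  let ?g = "\<lambda>x. min 1 (max 0 (f x))"
  have "continuous_map X euclideanreal ?g"
    using assms by (intro continuous_map_real_min continuous_map_real_max) simp_all
  then have "continuous_map X (top_of_set {0..1}) ?g"
    by (auto simp: continuous_map_in_subtopology)
  then have "zero_set_in X {x \<in> topspace X. ?g x = 0}"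
    unfolding zero_set_in_def by blast
  moreover have "{x \<in> topspace X. 0 < f x} = topspace X - {x \<in> topspace X. ?g x = 0}"
    by (auto simp: min_def max_def)
  ultimately show ?thesis
    unfolding Coz_def by blast
qed

lemma Coz_imp_positive_set:
  assumes "C \<in> Coz X"
  shows "\<exists>f. continuous_map X euclideanreal f \<and> (\<forall>x \<in> topspace X. 0 \<le> f x) \<and>
    C = {x \<in> topspace X. 0 < f x}"
proof -
  obtain f where f: "continuous_map X (top_of_set {0..1::real}) f"
    and C: "C = topspace X - {x \<in> topspace X. f x = 0}"
    using assms unfolding Coz_def zero_set_in_def by blast
  have pos: "\<forall>x \<in> topspace X. 0 \<le> f x"
    using f by (force simp: continuous_map_in_subtopology)
  moreover have "continuous_map X euclideanreal f"
    using f continuous_map_in_subtopology by blast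
  moreover have "C = {x \<in> topspace X. 0 < f x}"
    unfolding C using pos by force
  ultimately show ?thesis
    by blast
qed

section \<open>Closed subspaces with \<open>P\<close>\<close>

lemma P_Union_finite_closed:
  assumes "preserved_under_finite_closed_sums P" "finite \<F>"
    "\<And>S. S \<in> \<F> \<Longrightarrow> closedin X S \<and> P (subtopology X S)"
  shows "P (subtopology X (\<Union>\<F>))"
proof -
  have "closedin (subtopology X (\<Union>\<F>)) S \<and> P (subtopology (subtopology X (\<Union>\<F>)) S)"
    if S: "S \<in> \<F>" for S
  proof
    show "closedin (subtopology X (\<Union>\<F>)) S"
      by (rule closedin_subset_topspace[OF conjunct1[OF assms(3)[OF S]] Union_upper[OF S]])
    show "P (subtopology (subtopology X (\<Union>\<F>)) S)"
      using assms(3)[OF S] unfolding subtopology_subtopology Int_absorb1[OF Union_upper[OF S]]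
      by (rule conjunct2)
  qed
  moreover have "\<Union>\<F> = topspace (subtopology X (\<Union>\<F>))"
  proof -
    have "\<Union>\<F> \<subseteq> topspace X"
      by (intro Union_least closedin_subset conjunct1[OF assms(3)])
    then show ?thesis
      unfolding topspace_subtopology by (rule Int_absorb1[symmetric])
  qed
  ultimately show ?thesis
    by (intro assms(1)[unfolded preserved_under_finite_closed_sums_def, rule_format, OF assms(2)])
      simp_all
qed

lemma P_closed_subset:
  assumes "closed_hereditary P" "P (subtopology X T)" "closedin X S" "S \<subseteq> T"
  shows "P (subtopology X S)"
proof -
  have "closedin (subtopology X T) S"
    using assms(3,4) by (rule closedin_subset_topspace)
  then have "P (subtopology (subtopology X T) S)"
    using assms(1,2) unfolding closed_hereditary_def by blast
  then show ?thesis
    using assms(4) by (simp add: subtopology_subtopology Int_absorb1)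
qed

section \<open>Closures in \<open>X\<close> and in its compactification\<close>

lemma sc_embed_in_topspace:
  "x \<in> topspace X \<Longrightarrow> sc_embed X x \<in> topspace (stone_cech X)"
  unfolding stone_cech_def topspace_subtopology
  by (intro IntI subsetD[OF sc_embed_in_unit_cube] subsetD[OF sc_embed_in_closure] imageI)

lemma continuous_map_sc_embed:
  assumes "completely_regular_space X" "Hausdorff_space X"
  shows "continuous_map X (stone_cech X) (sc_embed X)"
  using homeomorphic_imp_continuous_map[OF embedding_map_sc_embed[OF assms, unfolded embedding_map_def]]
  by (simp add: continuous_map_in_subtopology)

text \<open>An embedding is a homeomorphism onto its image, so closures in \<open>X\<close> are
  traces of closures in the compactification; injectivity brings the point back to
  \<open>X\<close>.\<close>

lemma closure_of_sc_embed_preimage: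
  assumes "completely_regular_space X" "Hausdorff_space X" "C \<subseteq> topspace X" "x \<in> topspace X"
    and "sc_embed X x \<in> stone_cech X closure_of (sc_embed X ` C)"
  shows "x \<in> X closure_of C"
proof -
  let ?B = "stone_cech X" and ?e = "sc_embed X"
  let ?S = "subtopology ?B (?e ` topspace X)"
  have hom: "homeomorphic_map X ?S ?e"
    using embedding_map_sc_embed[OF assms(1,2)] by (simp add: embedding_map_def)
  have "?e x \<in> ?S closure_of (?e ` C)"
    using assms(4,5) image_mono[OF assms(3), of ?e]
    by (simp add: closure_of_subtopology Int_absorb1)
  then have "?e x \<in> ?e ` (X closure_of C)"
    using homeomorphic_map_closure_of[OF hom assms(3)] by simp
  moreover have "inj_on ?e (topspace X)"
    using hom homeomorphic_imp_injective_map by blast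
  ultimately show ?thesis
    using assms(4) closure_of_subset_topspace[of X C] by (simp add: inj_on_image_mem_iff)
qed

text \<open>The image of \<open>X\<close> is dense, so every neighbourhood of a point of
  \<open>U\<close> meets it inside \<open>U\<close>.\<close>

lemma open_stone_cech_subset_closure:
  assumes "openin (stone_cech X) U"
  shows "U \<subseteq> stone_cech X closure_of (sc_embed X ` {x \<in> topspace X. sc_embed X x \<in> U})"
proof -
  have "U = U \<inter> stone_cech X closure_of (sc_embed X ` topspace X)"
    unfolding dense_sc_embed using openin_subset[OF assms] by (rule Int_absorb2[symmetric])
  also have "\<dots> \<subseteq> stone_cech X closure_of (U \<inter> sc_embed X ` topspace X)"
    using assms by (rule openin_Int_closure_of_subset)
  also have "\<dots> \<subseteq> stone_cech X closure_of (sc_embed X ` {x \<in> topspace X. sc_embed X x \<in> U})"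
    by (rule closure_of_mono) blast
  finally show ?thesis .
qed

section \<open>Sets contained in \<open>P_lambda P X\<close>\<close>

lemma openin_P_lambda: "openin (stone_cech X) (P_lambda P X)"
  unfolding P_lambda_def by (rule openin_Union) (elim CollectE exE conjE, simp)

text \<open>By density \<open>U\<close> lies in the closure of its trace, hence in that of
  \<open>E\<close>; being open, it lies in the interior.\<close>

lemma open_subset_P_lambda:
  assumes "openin (stone_cech X) U" "E \<in> Coz X" "P (subtopology X (X closure_of E))"
    and "\<And>x. x \<in> topspace X \<Longrightarrow> sc_embed X x \<in> U \<Longrightarrow> x \<in> E"
  shows "U \<subseteq> P_lambda P X"
proof -
  have "U \<subseteq> stone_cech X closure_of (sc_embed X ` {x \<in> topspace X. sc_embed X x \<in> U})"
    using assms(1) by (rule open_stone_cech_subset_closure)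
  also have "\<dots> \<subseteq> stone_cech X closure_of (sc_embed X ` E)"
    using assms(4) by (intro closure_of_mono) auto
  finally have "U \<subseteq> stone_cech X interior_of (stone_cech X closure_of (sc_embed X ` E))"
    using assms(1) by (rule interior_of_maximal)
  also have "\<dots> \<subseteq> P_lambda P X"
    unfolding P_lambda_def by (intro Union_upper CollectI exI[of _ E] conjI refl assms(2,3))
  finally show ?thesis .
qed

text \<open>Finitely many of the interiors that form \<open>P_lambda P X\<close> cover the compact
  closure of \<open>A\<close>. The closures in \<open>X\<close> of the corresponding cozero-sets
  have a closed union with \<open>P\<close> that contains \<open>A\<close>, and \<open>P\<close>
  passes to the closure of \<open>A\<close>.\<close>

lemma P_closure_if_closure_subset_P_lambda:
  assumes "completely_regular_space X" "Hausdorff_space X"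
    and ch: "closed_hereditary P" and fs: "preserved_under_finite_closed_sums P"
    and A: "A \<subseteq> topspace X"
    and sub: "stone_cech X closure_of (sc_embed X ` A) \<subseteq> P_lambda P X"
  shows "P (subtopology X (X closure_of A))"
proof -
  let ?B = "stone_cech X" and ?e = "sc_embed X"
  let ?good = "{C \<in> Coz X. P (subtopology X (X closure_of C))}"
  let ?N = "\<lambda>C. ?B interior_of (?B closure_of (?e ` C))"
  have lam: "P_lambda P X = \<Union> (?N ` ?good)"
    unfolding P_lambda_def by blast
  have "compactin ?B (?B closure_of (?e ` A))"
    by (simp add: closedin_compact_space compact_space_stone_cech)
  moreover have "\<forall>U \<in> ?N ` ?good. openin ?B U"
    by auto
  ultimately obtain \<G> where \<G>: "finite \<G>" "\<G> \<subseteq> ?N ` ?good" "?B closure_of (?e ` A) \<subseteq> \<Union>\<G>"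
    using sub unfolding lam compactin_def by meson
  obtain \<C> where \<C>: "finite \<C>" "\<C> \<subseteq> ?good" "\<G> = ?N ` \<C>"
    using finite_subset_image[OF \<G>(1,2)] by blast
  let ?U = "\<Union> ((\<lambda>C. X closure_of C) ` \<C>)"
  have "P (subtopology X ?U)"
    using \<C> by (intro P_Union_finite_closed[OF fs]) auto
  moreover have "closedin X ?U"
    using \<C>(1) by (intro closedin_Union) auto
  moreover have "A \<subseteq> ?U"
  proof
    fix x assume x: "x \<in> A"
    have "?e ` A \<subseteq> topspace ?B"
      using A sc_embed_in_topspace by fast
    then have "?e x \<in> ?B closure_of (?e ` A)"
      using x closure_of_subset[of "?e ` A" ?B] by fast
    then have "?e x \<in> \<Union> (?N ` \<C>)"
      using \<G>(3) unfolding \<C>(3) by (rule rev_subsetD)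
    then obtain C where C: "C \<in> \<C>" "?e x \<in> ?N C"
      by blast
    then have "?e x \<in> ?B closure_of (?e ` C)"
      using interior_of_subset by fastforce
    moreover have "C \<subseteq> topspace X"
      using C(1) \<C>(2) by (auto simp: Coz_def)
    ultimately show "x \<in> ?U"
      using closure_of_sc_embed_preimage[OF assms(1,2)] x A C(1) by blast
  qed
  ultimately show ?thesis
    using P_closed_subset[OF ch, of X ?U "X closure_of A"] closure_of_minimal[of A ?U X]
    by simp
qed

lemma openin_real_preimage:
  assumes "continuous_map B euclideanreal F" "open S"
  shows "openin B {p \<in> topspace B. F p \<in> S}"
  by (rule openin_continuous_map_preimage[OF assms(1)]) (simp add: assms(2))

lemma closedin_real_preimage:
  assumes "continuous_map B euclideanreal F" "closed S"
  shows "closedin B {p \<in> topspace B. F p \<in> S}"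
  by (rule closedin_continuous_map_preimage[OF assms(1)]) (simp add: assms(2))

lemma P_closure_if_preimage_subset_P_lambda:
  assumes "completely_regular_space X" "Hausdorff_space X"
    and "closed_hereditary P" "preserved_under_finite_closed_sums P"
    and F: "continuous_map (stone_cech X) euclideanreal F" "closed S"
    and A: "A \<subseteq> topspace X" "\<And>x. x \<in> A \<Longrightarrow> F (sc_embed X x) \<in> S"
    and sub: "{p \<in> topspace (stone_cech X). F p \<in> S} \<subseteq> P_lambda P X"
  shows "P (subtopology X (X closure_of A))"
proof (rule P_closure_if_closure_subset_P_lambda[OF assms(1-4) A(1)])
  have "sc_embed X ` A \<subseteq> {p \<in> topspace (stone_cech X). F p \<in> S}"
    using A sc_embed_in_topspace[of _ X] by auto
  then show "stone_cech X closure_of (sc_embed X ` A) \<subseteq> P_lambda P X"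
    using closure_of_minimal[OF _ closedin_real_preimage[OF F]] sub by (meson order_trans)
qed

section \<open>From a disconnected remainder to a separation\<close>

lemma P_disconnected_if_remainder_disconnected:
  assumes X: "completely_regular_space X" "Hausdorff_space X"
    and P: "closed_hereditary P" "preserved_under_finite_closed_sums P"
    and disc: "\<not> connected_space
      (subtopology (stone_cech X) (topspace (stone_cech X) - P_lambda P X))"
  shows "P_disconnected P X"
proof -
  let ?B = "stone_cech X" and ?e = "sc_embed X" and ?L = "P_lambda P X"
  have clB: "closedin ?B (topspace ?B - ?L)"
    using openin_P_lambda by blast
  obtain H K where HK: "closedin (subtopology ?B (topspace ?B - ?L)) H"
      "closedin (subtopology ?B (topspace ?B - ?L)) K"
      "H \<union> K = topspace (subtopology ?B (topspace ?B - ?L))" "H \<inter> K = {}" "H \<noteq> {}" "K \<noteq> {}"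
    using disc unfolding connected_space_closedin_eq by blast
  then have cl: "closedin ?B H" "closedin ?B K"
    using clB closedin_closed_subtopology by blast+
  have un: "H \<union> K = topspace ?B - ?L"
    using HK(3) by auto
  have "normal_space ?B"
    by (simp add: compact_Hausdorff_or_regular_imp_normal_space compact_space_stone_cech
        Hausdorff_space_stone_cech)
  then obtain F where F0: "continuous_map ?B (top_of_set {0..1::real}) F"
    and FH: "F ` H \<subseteq> {0}" and FK: "F ` K \<subseteq> {1}"
    using Urysohn_lemma[of ?B H K 0 1] cl HK(4) by (auto simp: disjnt_def)
  have F: "continuous_map ?B euclideanreal F"
    using F0 continuous_map_in_subtopology by blast
  have Fe: "continuous_map X euclideanreal (\<lambda>x. F (?e x))"
    using continuous_map_compose[OF continuous_map_sc_embed[OF X] F] by (simp add: o_def)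
  \<comment> \<open>\<open>?C\<close> and \<open>?D\<close> leave only values of \<open>F\<close> in
    \<open>[1/3, 2/3]\<close> uncovered. The wider range of \<open>?E\<close> covers these and still
    stays away from the values \<open>0\<close> on \<open>H\<close> and \<open>1\<close> on
    \<open>K\<close>.\<close>
  let ?C = "{x \<in> topspace X. 0 < 1/3 - F (?e x)}"
  let ?D = "{x \<in> topspace X. 0 < F (?e x) - 2/3}"
  let ?E = "{x \<in> topspace X. 0 < min (F (?e x) - 1/4) (3/4 - F (?e x))}"
  have coz: "?C \<in> Coz X" "?D \<in> Coz X" "?E \<in> Coz X"
    by (intro Coz_positive_set continuous_intros continuous_map_real_min Fe; simp)+
  \<comment> \<open>\<open>Q\<close> witnesses that the open set \<open>F \<in> S\<close> leaves
    \<open>?L\<close>; if the closure of \<open>T\<close> had \<open>P\<close>, this open set, whose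
    trace lies in \<open>T\<close>, would be contained in \<open>?L\<close>.\<close>
  have not: "\<not> P (subtopology X (X closure_of T))"
    if "T \<in> Coz X" "open S" "Q \<noteq> {}" "Q \<subseteq> topspace ?B - ?L" "F ` Q \<subseteq> S"
      "\<And>x. x \<in> topspace X \<Longrightarrow> F (?e x) \<in> S \<Longrightarrow> x \<in> T" for T S Q
  proof
    assume "P (subtopology X (X closure_of T))"
    then have "{p \<in> topspace ?B. F p \<in> S} \<subseteq> ?L"
      using that(1,6) openin_real_preimage[OF F that(2)]
      by (intro open_subset_P_lambda[where E = T]) auto
    then show False
      using that(3-5) by blast
  qed
  have "\<not> P (subtopology X (X closure_of ?C))"
    using FH un HK(5) by (intro not[of _ "{..<1/3}" H] coz) auto
  moreover have "\<not> P (subtopology X (X closure_of ?D))"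
    using FK un HK(6) by (intro not[of _ "{2/3<..}" K] coz) auto
  moreover have "P (subtopology X (X closure_of ?E))"
  proof (rule P_closure_if_preimage_subset_P_lambda[OF X P F, of "{1/4..3/4}"])
    have "p \<in> ?L" if "p \<in> topspace ?B" "F p \<in> {1/4..3/4}" for p
    proof (rule ccontr)
      assume "p \<notin> ?L"
      then have "p \<in> H \<union> K"
        using that un by blast
      then have "F p = 0 \<or> F p = 1"
        using FH FK by blast
      then show False
        using that by auto
    qed
    then show "{p \<in> topspace ?B. F p \<in> {1/4..3/4}} \<subseteq> ?L"
      by blast
  qed auto
  moreover have "disjnt ?C ?D" "topspace X - (?C \<union> ?D) \<subseteq> ?E"
    by (auto simp: disjnt_def)
  ultimately have "P_separation P X ?C ?D"
    using coz unfolding P_separation_def by blast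
  then show ?thesis
    unfolding P_disconnected_def by blast
qed

section \<open>From a separation to a disconnected remainder\<close>

lemma remainder_disconnected_if_P_disconnected:
  assumes X: "completely_regular_space X" "Hausdorff_space X"
    and P: "closed_hereditary P" "preserved_under_finite_closed_sums P"
    and disc: "P_disconnected P X"
  shows "\<not> connected_space
      (subtopology (stone_cech X) (topspace (stone_cech X) - P_lambda P X))"
proof -
  let ?B = "stone_cech X" and ?e = "sc_embed X" and ?L = "P_lambda P X"
  obtain C D where "P_separation P X C D"
    using disc unfolding P_disconnected_def by blast
  then obtain E where CDE: "C \<in> Coz X" "D \<in> Coz X" "E \<in> Coz X" "disjnt C D"
      "topspace X - (C \<union> D) \<subseteq> E"
    and nP: "\<not> P (subtopology X (X closure_of C))" "\<not> P (subtopology X (X closure_of D))"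
    and PE: "P (subtopology X (X closure_of E))"
    unfolding P_separation_def by (elim conjE bexE) (rule that)
  obtain f where f: "continuous_map X euclideanreal f" "\<forall>x \<in> topspace X. 0 \<le> f x"
    "C = {x \<in> topspace X. 0 < f x}" using Coz_imp_positive_set[OF CDE(1)] by blast
  obtain g where g: "continuous_map X euclideanreal g" "\<forall>x \<in> topspace X. 0 \<le> g x"
    "D = {x \<in> topspace X. 0 < g x}" using Coz_imp_positive_set[OF CDE(2)] by blast
  obtain h where h: "continuous_map X euclideanreal h" "\<forall>x \<in> topspace X. 0 \<le> h x"
    "E = {x \<in> topspace X. 0 < h x}" using Coz_imp_positive_set[OF CDE(3)] by blast
  have pos: "0 < f x + g x + h x" if "x \<in> topspace X" for x
  proof -
    have "0 < f x \<or> 0 < g x \<or> 0 < h x"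
      using that f(3) g(3) h(3) CDE(5) by blast
    then show ?thesis
      using f(2)[rule_format, OF that] g(2)[rule_format, OF that] h(2)[rule_format, OF that] by linarith
  qed
  have fg: "f x = 0 \<or> g x = 0" if "x \<in> topspace X" for x
    using that f(2,3) g(2,3) CDE(4) by (force simp: disjnt_def)
  \<comment> \<open>This is \<open>(1 + (f - g) / (f + g + h)) / 2\<close> over a common
    denominator, which is positive because \<open>C\<close>, \<open>D\<close> and \<open>E\<close>
    cover \<open>X\<close>.\<close>
  define w where "w x = (2 * f x + h x) / (2 * (f x + g x + h x))" for x
  have "continuous_map X euclideanreal w"
    unfolding w_def using pos
    by (intro continuous_map_real_divide continuous_intros f g h) force+
  moreover have "w x \<in> {0..1}" if "x \<in> topspace X" for x
    using pos[OF that] f(2)[rule_format, OF that] g(2)[rule_format, OF that] h(2)[rule_format, OF that]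
    by (simp add: w_def field_simps)
  ultimately have "continuous_map X (top_of_set {0..1}) w"
    by (auto simp: continuous_map_in_subtopology)
  then obtain W where W0: "continuous_map ?B (top_of_set {0..1::real}) W"
    and We: "\<And>x. x \<in> topspace X \<Longrightarrow> W (?e x) = w x"
    using stone_cech_extension by blast
  have W: "continuous_map ?B euclideanreal W" and W01: "\<And>p. p \<in> topspace ?B \<Longrightarrow> W p \<in> {0..1}"
    using W0 by (auto simp: continuous_map_in_subtopology)
  \<comment> \<open>On \<open>C\<close> disjointness gives \<open>g = 0\<close>, so
    \<open>w = (2 * f + h) / (2 * f + 2 * h)\<close>; on \<open>D\<close>, symmetrically,
    \<open>f = 0\<close>.\<close>
  have wC: "1/2 \<le> w x" if "x \<in> C" for x
  proof -
    have x: "x \<in> topspace X" "0 < f x" using that f(3) by auto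
    then show ?thesis
      using fg[of x] pos[of x] h(2) by (auto simp: w_def field_simps)
  qed
  have wD: "w x \<le> 1/2" if "x \<in> D" for x
  proof -
    have x: "x \<in> topspace X" "0 < g x" using that g(3) by auto
    then show ?thesis
      using fg[of x] pos[of x] h(2) by (auto simp: w_def field_simps)
  qed
  \<comment> \<open>Outside \<open>E\<close> both \<open>h\<close> and one of \<open>f\<close>,
    \<open>g\<close> vanish, which forces \<open>w\<close> to be \<open>0\<close> or
    \<open>1\<close>.\<close>
  have wE: "x \<in> E" if "x \<in> topspace X" "w x \<in> {0<..<1}" for x
  proof (rule ccontr)
    assume "x \<notin> E"
    then have "h x = 0" using that(1) h(2,3) by force
    then show False
      using that fg[of x] pos[of x] by (auto simp: w_def)
  qed
  have mid: "{p \<in> topspace ?B. W p \<in> {0<..<1}} \<subseteq> ?L"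
    using wE We
    by (intro open_subset_P_lambda[where E = E and P = P] openin_real_preimage[OF W] CDE(3) PE) auto
  have W_remainder: "W p = 0 \<or> W p = 1" if "p \<in> topspace ?B" "p \<notin> ?L" for p
  proof -
    have "W p \<notin> {0<..<1}"
      using mid that by blast
    then show ?thesis
      using W01[OF that(1)] by auto
  qed
  let ?R = "subtopology ?B (topspace ?B - ?L)"
  let ?H = "\<lambda>c. (topspace ?B - ?L) \<inter> {p \<in> topspace ?B. W p \<in> {c}}"
  have cl: "closedin ?R (?H c)" for c
    by (intro closedin_subtopology_Int_closed closedin_real_preimage[OF W] closed_singleton)
  \<comment> \<open>\<open>W\<close> takes only the values \<open>0\<close> and \<open>1\<close> off
    \<open>?L\<close>. Without the value \<open>1\<close> there, the closed set
    \<open>W \<ge> 1/2\<close>, which contains the image of \<open>C\<close>, would lie in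
    \<open>?L\<close>.\<close>
  have ne1: "?H 1 \<noteq> {}"
  proof
    assume *: "?H 1 = {}"
    have "p \<in> ?L" if "p \<in> topspace ?B" "W p \<in> {1/2..}" for p
    proof (rule ccontr)
      assume "p \<notin> ?L"
      then show False
        using W_remainder[OF that(1)] that * by auto
    qed
    then have "{p \<in> topspace ?B. W p \<in> {1/2..}} \<subseteq> ?L"
      by blast
    then have "P (subtopology X (X closure_of C))"
      using wC We f(3)
      by (intro P_closure_if_preimage_subset_P_lambda[OF X P W, of "{1/2..}"]) auto
    then show False
      using nP by blast
  qed
  \<comment> \<open>The mirror argument uses \<open>W \<le> 1/2\<close>, which contains the image of
    \<open>D\<close>.\<close>
  have ne0: "?H 0 \<noteq> {}"
  proof
    assume *: "?H 0 = {}"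
    have "p \<in> ?L" if "p \<in> topspace ?B" "W p \<in> {..1/2}" for p
    proof (rule ccontr)
      assume "p \<notin> ?L"
      then show False
        using W_remainder[OF that(1)] that * by auto
    qed
    then have "{p \<in> topspace ?B. W p \<in> {..1/2}} \<subseteq> ?L"
      by blast
    then have "P (subtopology X (X closure_of D))"
      using wD We g(3)
      by (intro P_closure_if_preimage_subset_P_lambda[OF X P W, of "{..1/2}"]) auto
    then show False
      using nP by blast
  qed
  have un: "?H 0 \<union> ?H 1 = topspace ?R"
    using W_remainder by auto
  have disj: "?H 0 \<inter> ?H 1 = {}"
    by auto
  have "\<exists>H K. closedin ?R H \<and> closedin ?R K \<and> H \<union> K = topspace ?R \<and> H \<inter> K = {} \<and>
      H \<noteq> {} \<and> K \<noteq> {}"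
    by (intro exI[of _ "?H 0"] exI[of _ "?H 1"] conjI cl un disj ne0 ne1)
  then show ?thesis
    by (simp only: connected_space_closedin_eq not_not)
qed

theorem theorem3p9:
  fixes X :: "'a topology" and P :: "'a topology \<Rightarrow> bool"
  assumes "completely_regular_space X" and "Hausdorff_space X"
    and "topological_property P"
    and "closed_hereditary P"
    and "preserved_under_finite_closed_sums P"
  shows "P_connected P X \<longleftrightarrow>
    connected_space (subtopology (stone_cech X) (topspace (stone_cech X) - P_lambda P X))"
  unfolding P_connected_def
proof
  assume "connected_space (subtopology (stone_cech X) (topspace (stone_cech X) - P_lambda P X))"
  with remainder_disconnected_if_P_disconnected[OF assms(1,2,4,5)] show "\<not> P_disconnected P X"
    by (rule contrapos_pn[rotated])
next
  assume "\<not> P_disconnected P X"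
  then show "connected_space (subtopology (stone_cech X) (topspace (stone_cech X) - P_lambda P X))"
    using P_disconnected_if_remainder_disconnected[OF assms(1,2,4,5)] by (rule contrapos_np)
qed

end
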